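(* Let $k\in\mathbb{Z}_{\ge 0}$ and let $b$ be a $k$-generalized Markov number. Suppose there exist a prime $p$ and $m\in \mathbb{Z}_{\geq 2}$ such that $b=p^m$ or $b=2p^m$, and such that at least one of the following three conditions is satisfied: (1) $k=2$; (2) $k\geq 4$ is even, and neither $\frac{k}{2}+1$ nor $\frac{k}{2}-1$ is divisible by $p^2$; (3) $k$ is odd, and neither $k+2$ nor $k-2$ is divisible by $p^2$. Then there is a unique $k$-generalized Markov triple $(a,b,c)$, up to order, such that $\max\{a,b,c\}=b$.
   Context: For $k\in\mathbb{Z}_{\ge 0}$, the $k$-generalized Markov equation is $x^2+y^2+z^2+k(yz+zx+xy)=(3+3k)xyz$. A $k$-generalized Markov triple is a positive integer solution $(a,b,c)$ of this equation (considered up to order when counting). A $k$-generalized Markov number is a positive integer appearing as an entry of some $k$-generalized Markov triple. *)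

theory Defs
  imports "HOL-Computational_Algebra.Primes" "HOL-Library.Multiset"
begin

definition gen_markov_triple :: "nat \<Rightarrow> nat \<Rightarrow> nat \<Rightarrow> nat \<Rightarrow> bool" where
  "gen_markov_triple k x y z \<longleftrightarrow>
     x > 0 \<and> y > 0 \<and> z > 0 \<and>
     x\<^sup>2 + y\<^sup>2 + z\<^sup>2 + k * (y * z + z * x + x * y) = (3 + 3 * k) * x * y * z"

definition gen_markov_number :: "nat \<Rightarrow> nat \<Rightarrow> bool" where
  "gen_markov_number k n \<longleftrightarrow> (\<exists>x y z. gen_markov_triple k x y z \<and> n \<in> {x, y, z})"

end

theory Submission
  imports Defs Complex_Main
begin

text \<open>
  If \<open>b\<close> is the maximum of a triple \<open>(a, b, c)\<close>, then \<open>v = c / a\<close> is a root of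
  \<open>t\<^sup>2 + k t + 1\<close> modulo \<open>b\<close>. All entries are congruent to 1 modulo \<open>k + 1\<close>, so the residue
  lifts to a number \<open>v\<close> divisible by \<open>k + 1\<close> that is determined modulo \<open>(k + 1) b\<close>.
  Along the Markov tree, ordered like the Farey tree, the lifts can be chosen
  such that the slopes \<open>(2 v + k) / b\<close> increase strictly from left to right, and up to swapping
  \<open>a\<close> and \<open>c\<close> every large triple occurs in the half of the tree whose slopes lie strictly
  between \<open>k\<close> and \<open>2 k + 1\<close>. The two roots \<open>v\<close> and \<open>- k - v\<close> have slopes that are
  symmetric about \<open>2 k + 1\<close> up to multiples of the period \<open>2 (k + 1)\<close>, so
  only one lift of one of them fits this interval, and it determines the triple whenever there
  are no further roots modulo \<open>b\<close>. For \<open>k = 2\<close> the two roots collapse, but there the entries are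
  the squares of an ordinary Markov triple.
\<close>

section \<open>Vieta jumping and descent to the triple of ones\<close>

definition markov :: "int \<Rightarrow> int \<Rightarrow> int \<Rightarrow> int \<Rightarrow> bool" where
  "markov k a b c \<longleftrightarrow> a > 0 \<and> b > 0 \<and> c > 0 \<and>
     a\<^sup>2 + b\<^sup>2 + c\<^sup>2 + k * (b * c + c * a + a * b) = (3 + 3 * k) * a * b * c"

lemma gen_markov_triple_iff: "gen_markov_triple k x y z \<longleftrightarrow> markov (int k) (int x) (int y) (int z)"
proof -
  have "x\<^sup>2 + y\<^sup>2 + z\<^sup>2 + k * (y * z + z * x + x * y) = (3 + 3 * k) * x * y * z \<longleftrightarrow>
    int (x\<^sup>2 + y\<^sup>2 + z\<^sup>2 + k * (y * z + z * x + x * y)) = int ((3 + 3 * k) * x * y * z)"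
    by (simp only: of_nat_eq_iff)
  then show ?thesis
    by (simp add: gen_markov_triple_def markov_def)
qed

lemma markov_swap12: "markov k a b c \<Longrightarrow> markov k b a c"
  by (simp add: markov_def algebra_simps)

lemma markov_swap23: "markov k a b c \<Longrightarrow> markov k a c b"
  by (simp add: markov_def algebra_simps)

lemma markov_swap13: "markov k a b c \<Longrightarrow> markov k c b a"
  by (simp add: markov_def algebra_simps)

text \<open>The second root of the equation read as a quadratic in \<open>b\<close> with
  \<open>a\<close> and \<open>c\<close> fixed. The formula is the sum of the roots minus
  \<open>b\<close>; \<open>vieta_mult\<close> gives their product.\<close>

definition vieta :: "int \<Rightarrow> int \<Rightarrow> int \<Rightarrow> int \<Rightarrow> int" where
  "vieta k a b c = (3 + 3 * k) * a * c - k * (a + c) - b"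

lemma vieta_mult:
  assumes "markov k a b c"
  shows "b * vieta k a b c = a\<^sup>2 + k * a * c + c\<^sup>2"
  using assms by (simp add: markov_def vieta_def power2_eq_square algebra_simps)

lemma vieta_vieta: "vieta k a (vieta k a b c) c = b"
  by (simp add: vieta_def)

lemma markov_vieta:
  assumes "k \<ge> 0" "markov k a b c"
  shows "markov k a (vieta k a b c) c"
proof -
  have pos: "a > 0" "b > 0" "c > 0"
    using assms by (auto simp: markov_def)
  have "0 < a\<^sup>2 + k * a * c + c\<^sup>2"
    using assms pos by (intro add_pos_pos add_pos_nonneg) auto
  then have "vieta k a b c > 0"
    using vieta_mult[OF assms(2)] pos by (metis zero_less_mult_pos)
  then show ?thesis
    using pos vieta_mult[OF assms(2)] unfolding markov_def
    by (simp add: vieta_def power2_eq_square algebra_simps)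
qed

text \<open>Bounding \<open>c\<^sup>2\<close> by \<open>b * c\<close> and cancelling a factor
  \<open>b\<close> leaves a linear inequality. Replacing \<open>b\<close> by the smaller
  \<open>c\<close> on its left forces \<open>c = 1\<close>, and then \<open>b = 1\<close>.\<close>

lemma markov_max_repeated:
  assumes k: "k \<ge> 0" and m: "markov k b b c" and le: "c \<le> b"
  shows "b = 1 \<and> c = 1"
proof -
  have pos: "b > 0" "c > 0"
    using m by (auto simp: markov_def)
  have "b\<^sup>2 * ((3 + 3 * k) * c - 2 - k) = 2 * k * b * c + c\<^sup>2"
    using m by (simp add: markov_def power2_eq_square algebra_simps)
  also have "\<dots> \<le> 2 * k * b * c + b * c"
    using pos le by (simp add: power2_eq_square)
  finally have "b * (b * ((3 + 3 * k) * c - 2 - k)) \<le> b * ((2 * k + 1) * c)"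
    by (simp add: power2_eq_square algebra_simps)
  then have *: "b * ((3 + 3 * k) * c - 2 - k) \<le> (2 * k + 1) * c"
    using pos by simp
  have "(3 + 3 * k) * c \<ge> 3 + 3 * k"
    using pos k mult_left_mono[of 1 c "3 + 3 * k"] by simp
  then have "c * ((3 + 3 * k) * c - 2 - k) \<le> b * ((3 + 3 * k) * c - 2 - k)"
    using le k by (intro mult_right_mono) linarith+
  with * have "c * ((3 + 3 * k) * c - 2 - k) \<le> c * (2 * k + 1)"
    by (simp add: mult.commute)
  then have "(3 + 3 * k) * c \<le> (3 + 3 * k) * 1"
    using pos by simp
  then have c: "c = 1"
    using k pos by (subst (asm) mult_le_cancel_left_pos) auto
  then have "(2 * k + 1) * b \<le> (2 * k + 1) * 1"
    using * by (simp add: algebra_simps)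
  then show ?thesis
    using c k pos by (subst (asm) mult_le_cancel_left_pos) auto
qed

text \<open>The product \<open>(b - a) * (vieta k a b c - a)\<close> is the quadratic with roots
  \<open>b\<close> and \<open>vieta k a b c\<close> evaluated at \<open>a\<close>. It is at most 0,
  so \<open>a\<close> lies between the roots.\<close>

lemma vieta_le:
  assumes k: "k \<ge> 0" and m: "markov k a b c" and "c \<le> a" "a < b"
  shows "vieta k a b c \<le> a"
proof -
  have pos: "a > 0" "b > 0" "c > 0"
    using m by (auto simp: markov_def)
  have 1: "c * c \<le> a * a * c"
    using pos \<open>c \<le> a\<close> by (simp add: mult_le_cancel_right)
      (smt (verit) mult_le_cancel_left1)
  have 2: "a * a \<le> a * a * c"
    using pos by (simp add: mult_le_cancel_left1)
  have 3: "k * (a * c) \<le> k * (a * a * c)" "k * (a * a) \<le> k * (a * a * c)"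
    using pos k 2 by (auto intro!: mult_left_mono simp: mult_le_cancel_right)
  have "(b - a) * (vieta k a b c - a) = b * vieta k a b c - a * (b + vieta k a b c) + a * a"
    by (simp add: algebra_simps)
  also have "\<dots> = 2 * (a * a) + c * c + 2 * (k * (a * c)) + k * (a * a) - (3 + 3 * k) * (a * a * c)"
    unfolding vieta_mult[OF m] by (simp add: vieta_def power2_eq_square algebra_simps)
  also have "\<dots> \<le> 0"
    using 1 2 3 by (simp add: algebra_simps)
  finally show ?thesis
    using \<open>a < b\<close> by (simp add: mult_le_0_iff)
qed

lemma vieta_less:
  assumes k: "k \<ge> 0" and m: "markov k a b c" and "a < b" "c < b"
  shows "vieta k a b c < b"
proof (cases "c \<le> a")
  case True
  then show ?thesis
    using vieta_le[OF k m] assms by simp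
next
  case False
  have "vieta k a b c = vieta k c b a"
    by (simp add: vieta_def algebra_simps)
  then show ?thesis
    using vieta_le[OF k markov_swap13[OF m]] assms False by simp
qed

text \<open>Descent on the sum of the entries: a jump at a strict maximum lowers it, a repeated
  maximum leaves only the triple of ones, and \<open>vieta_vieta\<close> undoes the jump.\<close>

lemma markov_induct [consumes 2, case_names base swap12 swap23 step]:
  assumes k: "k \<ge> 0" and m: "markov k a b c"
    and base: "P 1 1 1"
    and swap12: "\<And>a b c. P a b c \<Longrightarrow> P b a c"
    and swap23: "\<And>a b c. P a b c \<Longrightarrow> P a c b"
    and step: "\<And>a b c. markov k a b c \<Longrightarrow> P a b c \<Longrightarrow> P a (vieta k a b c) c"
  shows "P a b c"
  using m
proof (induction "nat (a + b + c)" arbitrary: a b c rule: less_induct)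
  case less
  have sorted: "P x y z" if m: "markov k x y z" and s: "x + y + z = a + b + c"
    and le: "x \<le> y" "z \<le> y" for x y z
  proof (cases "x = y \<or> z = y")
    case True
    then have "x = 1 \<and> y = 1 \<and> z = 1"
      using markov_max_repeated[OF k, of y z] markov_max_repeated[OF k, of y x] m le
        markov_swap12 markov_swap23 by metis
    then show ?thesis
      using base by simp
  next
    case False
    let ?d = "vieta k x y z"
    have m': "markov k x ?d z"
      using k m by (rule markov_vieta)
    moreover have "?d < y"
      using vieta_less[OF k m] False le by simp
    ultimately have "P x ?d z"
      using less.hyps[of x ?d z] s m by (simp add: markov_def)
    from step[OF m' this] show ?thesis
      by (simp add: vieta_vieta)
  qed
  consider "a \<le> b" "c \<le> b" | "b \<le> a" "c \<le> a" | "a \<le> c" "b \<le> c"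
    by linarith
  then show ?case
  proof cases
    case 1
    then show ?thesis
      using sorted less.prems by simp
  next
    case 2
    then show ?thesis
      using sorted[of b a c] less.prems swap12 markov_swap12 by simp
  next
    case 3
    then show ?thesis
      using sorted[of a c b] less.prems swap23 markov_swap23 by simp
  qed
qed

section \<open>Arithmetic of the entries, and descent to a prescribed maximum\<close>

text \<open>By \<open>vieta_mult\<close>, \<open>b\<close> times the new entry is
  \<open>c\<^sup>2\<close> modulo \<open>a\<close> and \<open>a\<^sup>2\<close> modulo
  \<open>c\<close>, so coprimality of \<open>a\<close> and \<open>c\<close> passes to the new
  entry.\<close>

lemma markov_coprime:
  assumes "k \<ge> 0" "markov k a b c"
  shows "coprime a b \<and> coprime b c \<and> coprime a c"
  using assms
proof (induction rule: markov_induct)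
  case (step a b c)
  have "coprime a (c\<^sup>2)" "coprime c (a\<^sup>2)"
    using step by (auto simp: coprime_commute)
  then have "coprime a ((a + k * c) * a + c\<^sup>2)" "coprime c ((c + k * a) * c + a\<^sup>2)"
    unfolding coprime_iff_gcd_eq_1 gcd_add_mult by auto
  moreover have "b * vieta k a b c = (a + k * c) * a + c\<^sup>2"
    "b * vieta k a b c = (c + k * a) * c + a\<^sup>2"
    using vieta_mult[OF step(1)] by (auto simp: power2_eq_square algebra_simps)
  ultimately show ?case
    using step by (metis coprime_commute coprime_mult_right_iff)
qed (auto simp: coprime_commute)

text \<open>Modulo \<open>k + 1\<close> the cubic coefficient vanishes and \<open>k\<close> becomes
  -1. A jump then replaces \<open>b\<close> by \<open>a + c - b\<close>, which preserves the residue
  1.\<close>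

lemma markov_mod_Suc:
  assumes "k \<ge> 0" "markov k a b c"
  shows "k + 1 dvd a - 1 \<and> k + 1 dvd b - 1 \<and> k + 1 dvd c - 1"
  using assms
proof (induction rule: markov_induct)
  case (step a b c)
  have "vieta k a b c - 1 = (k + 1) * (3 * a * c - a - c) + (a - 1) + (c - 1) - (b - 1)"
    by (simp add: vieta_def algebra_simps)
  then show ?case
    using step by (metis dvd_add dvd_diff dvd_triv_left)
qed auto

text \<open>For \<open>k = 2\<close> the product of the two roots is \<open>(a + c)\<^sup>2\<close>,
  so if one root is a square, so is the other.\<close>

lemma markov2_squares:
  assumes "markov 2 a b c"
  shows "\<exists>x y z. x > 0 \<and> y > 0 \<and> z > 0 \<and> a = x\<^sup>2 \<and> b = y\<^sup>2 \<and> c = z\<^sup>2 \<and> markov 0 x y z"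
proof -
  have "(\<exists>x>0. a = x\<^sup>2) \<and> (\<exists>y>0. b = y\<^sup>2) \<and> (\<exists>z>0. c = z\<^sup>2)"
    using zero_le_numeral assms
  proof (induction rule: markov_induct)
    case base
    show ?case
      by (metis one_power2 zero_less_one)
  next
    case (step a b c)
    then obtain y where y: "y > 0" "b = y\<^sup>2"
      by auto
    have eq: "y\<^sup>2 * vieta 2 a b c = (a + c)\<^sup>2"
      using vieta_mult[OF step(1)] y by (simp add: power2_eq_square algebra_simps)
    then have "y\<^sup>2 dvd (a + c)\<^sup>2"
      by (metis dvd_triv_left)
    then have "y dvd a + c"
      by simp
    then obtain q where q: "a + c = y * q" ..
    then have "vieta 2 a b c = q\<^sup>2"
      using eq y by (simp add: power_mult_distrib)
    moreover have "q > 0"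
      using q y step(1) by (metis add_pos_pos markov_def zero_less_mult_pos)
    ultimately show ?case
      using step by blast
  qed blast+
  then obtain x y z where xyz: "x > 0" "y > 0" "z > 0" "a = x\<^sup>2" "b = y\<^sup>2" "c = z\<^sup>2"
    by blast
  \<comment> \<open>For \<open>k = 2\<close> the equation reads
    \<open>(a + b + c)\<^sup>2 = 9 * a * b * c\<close>, whose positive square root is the ordinary
    Markov equation.\<close>
  have "(x\<^sup>2 + y\<^sup>2 + z\<^sup>2)\<^sup>2 = (3 * x * y * z)\<^sup>2"
    using assms by (simp add: xyz markov_def power2_eq_square algebra_simps)
  then have "x\<^sup>2 + y\<^sup>2 + z\<^sup>2 = 3 * x * y * z"
    by (rule power2_eq_imp_eq) (use xyz in auto)
  then show ?thesis
    using xyz by (auto simp: markov_def)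
qed

text \<open>A descent step removes only the strict maximum, so \<open>n\<close> survives until it is
  itself the maximum.\<close>

lemma markov_exists_max:
  assumes k: "k \<ge> 0" and m: "markov k a b c" and n: "n \<in> {a, b, c}"
  shows "\<exists>x z. markov k x n z \<and> x \<le> n \<and> z \<le> n"
  using m n
proof (induction "nat (a + b + c)" arbitrary: a b c rule: less_induct)
  case less
  have sorted: ?case if m: "markov k x y z" and s: "x + y + z = a + b + c"
    and le: "x \<le> y" "z \<le> y" and n: "n \<in> {x, y, z}" for x y z
  proof (cases "x = y \<or> z = y \<or> n = y")
    case True
    moreover have "x = 1 \<and> y = 1 \<and> z = 1" if "x = y \<or> z = y"
      using markov_max_repeated[OF k, of y z] markov_max_repeated[OF k, of y x] m le that
        markov_swap12 markov_swap23 by metis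
    ultimately have "n = y"
      using n by auto
    then show ?thesis
      using m le by blast
  next
    case False
    let ?d = "vieta k x y z"
    have m': "markov k x ?d z"
      using k m by (rule markov_vieta)
    moreover have "?d < y"
      using vieta_less[OF k m] False le by simp
    ultimately show ?thesis
      using less.hyps[of x ?d z] s n False m[unfolded markov_def] by auto
  qed
  consider "a \<le> b" "c \<le> b" | "b \<le> a" "c \<le> a" | "a \<le> c" "b \<le> c"
    by linarith
  then show ?case
  proof cases
    case 1
    then show ?thesis
      using sorted[of a b c] less.prems by simp
  next
    case 2
    then show ?thesis
      using sorted[of b a c] less.prems markov_swap12 by auto
  next
    case 3
    then show ?thesis
      using sorted[of a c b] less.prems markov_swap23 by auto
  qed
qed

section \<open>Lifted residues and the order of slopes along the tree\<close>

type_synonym state = "int \<times> int \<times> int \<times> int \<times> int \<times> int"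

text \<open>
  The residue recursions are linear forms of the conditions in \<open>valid\<close> below; they
  reflect the trace identity for Cohn matrices and avoid a division by \<open>a\<close> or \<open>c\<close>.
\<close>

fun child :: "int \<Rightarrow> state \<Rightarrow> bool \<Rightarrow> state" where
  "child k (a, u, b, v, c, w) True =
     (a, u, vieta k a c b, ((3 + 3 * k) * a - k) * v - w - k * u - k * (k + 1), b, v)"
| "child k (a, u, b, v, c, w) False =
     (b, v, vieta k b a c, ((3 + 3 * k) * c - k) * (v + k) - u - k * w - k, c, w)"

text \<open>
  A state lists a triple, each entry followed by its lifted residue. The relations say that neighbouring slopes differ by \<open>2 c / (a b) + k (1 / a + 1 / b)\<close>, which is
  what makes them additive under Vieta jumping.
\<close>

definition valid :: "int \<Rightarrow> state \<Rightarrow> bool" where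
  "valid k = (\<lambda>(a, u, b, v, c, w). markov k a b c \<and> v * a - u * b = c + k * b \<and>
     w * b - v * c = a + k * c \<and> k + 1 dvd u \<and> k + 1 dvd v \<and> k + 1 dvd w)"

text \<open>Centred at \<open>- k / 2\<close>, so that the symmetry sending \<open>u\<close> to
  \<open>- k - u\<close> negates the slope. Adding \<open>(k + 1) * m\<close> to \<open>u\<close>
  adds the period \<open>2 * (k + 1)\<close>.\<close>

definition slope :: "int \<Rightarrow> int \<Rightarrow> int \<Rightarrow> real" where
  "slope k m u = of_int (2 * u + k) / of_int m"

text \<open>Multiplying by \<open>b\<close> and eliminating \<open>v\<close> and
  \<open>w * b\<close> through the relations in \<open>valid\<close> leaves the product from
  \<open>vieta_mult\<close>; then \<open>b\<close> cancels.\<close>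

lemma valid_outer:
  assumes "valid k (a, u, b, v, c, w)"
  shows "w * a - u * c = vieta k a b c + k * c"
proof -
  have *: "v * a = u * b + c + k * b" "w * b = v * c + a + k * c" and m: "markov k a b c"
    using assms by (auto simp: valid_def)
  have "b * (w * a - u * c) = a * (w * b) - c * u * b"
    by (simp add: algebra_simps)
  also have "\<dots> = a * a + k * a * c + c * (v * a) - c * u * b"
    unfolding *(2) by (simp add: algebra_simps)
  also have "\<dots> = b * vieta k a b c + b * (k * c)"
    unfolding *(1) vieta_mult[OF m] by (simp add: algebra_simps power2_eq_square)
  finally have "b * (w * a - u * c) = b * (vieta k a b c + k * c)"
    by (simp add: algebra_simps)
  then show ?thesis
    using m by (auto simp: markov_def)
qed

text \<open>One of the two new relations follows from the linear recursion by substituting the old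
  ones. The other is proved after multiplication by the retained outer entry, which then
  cancels.\<close>

lemma valid_child:
  assumes k: "k \<ge> 0" and v: "valid k S"
  shows "valid k (child k S d)"
proof -
  obtain a u b v c w where S: "S = (a, u, b, v, c, w)"
    by (cases S)
  have m: "markov k a b c" and r1: "v * a = u * b + c + k * b" and r2: "w * b = v * c + a + k * c"
    and dvds: "k + 1 dvd u" "k + 1 dvd v" "k + 1 dvd w"
    using v by (auto simp: valid_def S)
  have r3: "w * a = u * c + vieta k a b c + k * c"
    using valid_outer[of k a u b v c w] v by (simp add: S)
  have pos: "a > 0" "b > 0" "c > 0"
    using m by (auto simp: markov_def)
  show ?thesis
  proof (cases d)
    case True
    define m' where "m' = vieta k a c b"
    define v' where "v' = ((3 + 3 * k) * a - k) * v - w - k * u - k * (k + 1)"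
    have M: "markov k a m' b"
      unfolding m'_def by (rule markov_vieta[OF k markov_swap23[OF m]])
    have cm: "c * m' = a\<^sup>2 + k * a * b + b\<^sup>2"
      unfolding m'_def by (rule vieta_mult[OF markov_swap23[OF m]])
    have "v' * a = ((3 + 3 * k) * a - k) * (v * a) - w * a - k * u * a - k * (k + 1) * a"
      by (simp add: v'_def algebra_simps)
    also have "\<dots> = u * m' + b + k * m'"
      unfolding r1 r3 by (simp add: m'_def vieta_def algebra_simps)
    finally have e1: "v' * a = u * m' + b + k * m'" .
    have "a * (v * m' - v' * b) = (v * a) * m' - (v' * a) * b"
      by (simp add: algebra_simps)
    also have "\<dots> = c * m' - b\<^sup>2"
      unfolding r1 e1 by (simp add: algebra_simps power2_eq_square)
    also have "\<dots> = a * (a + k * b)"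
      unfolding cm by (simp add: algebra_simps power2_eq_square)
    finally have e2: "v * m' - v' * b = a + k * b"
      using pos by simp
    \<comment> \<open>Modulo \<open>k + 1\<close> the recursion reads \<open>v + u - w\<close>, so
      divisibility is inherited.\<close>
    have "v' = (k + 1) * (3 * a * v - v - u - k) + v + u - w"
      by (simp add: v'_def algebra_simps)
    then have "k + 1 dvd v'"
      using dvds by simp
    then show ?thesis
      using True M e1 e2 dvds unfolding S valid_def m'_def v'_def by simp
  next
    case False
    define m' where "m' = vieta k b a c"
    define v' where "v' = ((3 + 3 * k) * c - k) * (v + k) - u - k * w - k"
    have M: "markov k b m' c"
      unfolding m'_def by (rule markov_vieta[OF k markov_swap12[OF m]])
    have am: "a * m' = b\<^sup>2 + k * b * c + c\<^sup>2"
      unfolding m'_def by (rule vieta_mult[OF markov_swap12[OF m]])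
    have q1: "v * c = w * b - a - k * c" and q3: "u * c = w * a - vieta k a b c - k * c"
      using r2 r3 by auto
    have "v' * c = ((3 + 3 * k) * c - k) * (v * c + k * c) - u * c - k * w * c - k * c"
      by (simp add: v'_def algebra_simps)
    also have "\<dots> = w * m' - b - k * c"
      unfolding q1 q3 by (simp add: m'_def vieta_def algebra_simps)
    finally have e1: "v' * c = w * m' - b - k * c" .
    have "c * (v' * b - v * m') = (v' * c) * b - (v * c) * m'"
      by (simp add: algebra_simps)
    also have "\<dots> = a * m' - b\<^sup>2 - k * b * c + k * c * m'"
      unfolding q1 e1 by (simp add: algebra_simps power2_eq_square)
    also have "\<dots> = c * (c + k * m')"
      unfolding am by (simp add: algebra_simps power2_eq_square)
    finally have e2: "v' * b - v * m' = c + k * m'"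
      using pos by simp
    have "v' = (k + 1) * (3 * c * (v + k) - v - k - w) + v + w - u"
      by (simp add: v'_def algebra_simps)
    then have "k + 1 dvd v'"
      using dvds by simp
    then show ?thesis
      using False M e1 e2 dvds unfolding S valid_def m'_def v'_def by simp
  qed
qed

lemma valid_descendant:
  assumes "k \<ge> 0" "valid k S"
  shows "valid k (foldl (child k) S ds)"
  using assms(2) by (induction ds arbitrary: S) (auto simp: valid_child[OF assms(1)])

lemma valid_slopes:
  assumes k: "k \<ge> 0" and v: "valid k (a, u, b, v, c, w)"
  shows "slope k a u < slope k b v" "slope k b v < slope k c w"
proof -
  have pos: "a > 0" "b > 0" "c > 0" and *: "v * a - u * b = c + k * b" "w * b - v * c = a + k * c"
    using v by (auto simp: valid_def markov_def)
  have "k * a \<ge> 0" "k * b \<ge> 0" "k * c \<ge> 0"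
    using pos k by auto
  then have "(2 * u + k) * b < (2 * v + k) * a" "(2 * v + k) * c < (2 * w + k) * b"
    using * pos by (auto simp: algebra_simps)
  then have "real_of_int ((2 * u + k) * b) < of_int ((2 * v + k) * a)"
    "real_of_int ((2 * v + k) * c) < of_int ((2 * w + k) * b)"
    by (simp_all only: of_int_less_iff)
  then show "slope k a u < slope k b v" "slope k b v < slope k c w"
    using pos by (simp_all add: slope_def divide_simps mult.commute)
qed

definition mid_slope :: "int \<Rightarrow> state \<Rightarrow> real" where
  "mid_slope k = (\<lambda>(a, u, b, v, c, w). slope k b v)"

text \<open>A child keeps one outer entry and takes the old middle as the other, so the slope
  intervals are nested.\<close>

lemma descendant_slope:
  assumes k: "k \<ge> 0" and "valid k (a, u, b, v, c, w)"
  shows "slope k a u < mid_slope k (foldl (child k) (a, u, b, v, c, w) ds) \<and>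
         mid_slope k (foldl (child k) (a, u, b, v, c, w) ds) < slope k c w"
  using assms(2)
proof (induction ds arbitrary: a u b v c w)
  case Nil
  then show ?case
    using valid_slopes[OF k] by (simp add: mid_slope_def)
next
  case (Cons d ds)
  note v = valid_child[OF k Cons.prems, of d]
  show ?case
    using Cons.IH v valid_slopes[OF k Cons.prems]
    by (cases d) (fastforce simp del: foldl.simps simp: foldl_Cons)+
qed

text \<open>The middle entry is the right end of the \<open>True\<close> subtree and the left end of
  the \<open>False\<close> subtree, so its slope separates them.\<close>

lemma child_slope:
  assumes k: "k \<ge> 0" and v: "valid k S"
  shows "d \<Longrightarrow> mid_slope k (foldl (child k) S (d # ds)) < mid_slope k S"
    and "\<not> d \<Longrightarrow> mid_slope k S < mid_slope k (foldl (child k) S (d # ds))"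
proof -
  obtain a u b v c w where S: "S = (a, u, b, v, c, w)"
    by (cases S)
  show "d \<Longrightarrow> mid_slope k (foldl (child k) S (d # ds)) < mid_slope k S"
    using descendant_slope[OF k, of _ _ _ _ _ _ ds] valid_child[OF k v, of True]
    by (simp add: S mid_slope_def)
  show "\<not> d \<Longrightarrow> mid_slope k S < mid_slope k (foldl (child k) S (d # ds))"
    using descendant_slope[OF k, of _ _ _ _ _ _ ds] valid_child[OF k v, of False]
    by (simp add: S mid_slope_def)
qed

text \<open>The slopes order the tree as a search tree: paths that diverge at a node, or one of
  which ends there, are told apart by that node's slope.\<close>

lemma mid_slope_inj:
  assumes k: "k \<ge> 0" and "valid k S"
    and "mid_slope k (foldl (child k) S ds) = mid_slope k (foldl (child k) S es)"
  shows "ds = es"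
  using assms(2,3)
proof (induction ds arbitrary: S es)
  case Nil
  then show ?case
    using child_slope[OF k Nil.prems(1)]
    by (metis foldl_Nil less_irrefl list.exhaust)
next
  case (Cons d ds)
  then have "es \<noteq> []"
    using child_slope[OF k Cons.prems(1), of d ds] by (metis foldl_Nil less_irrefl)
  then obtain e es' where es: "es = e # es'"
    by (cases es) auto
  then have "e = d"
    using child_slope[OF k Cons.prems(1), of d ds] child_slope[OF k Cons.prems(1), of e es'] Cons.prems(2)
    by (metis less_asym)
  then show ?case
    using Cons.IH[of "child k S d" es'] Cons.prems valid_child[OF k] es by simp
qed

section \<open>The root of the half tree and the triples it generates\<close>

text \<open>
  The root bounds only the left half of the full tree, whose outer
  entries are both 1; the right half is its mirror image.
\<close>

definition root :: "int \<Rightarrow> state" where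
  "root k = (1, 0, vieta k 1 1 (k + 2), k + 2 + k * vieta k 1 1 (k + 2), k + 2, (k + 1)\<^sup>2)"

text \<open>With residue 0 at the left entry 1, the relations in \<open>valid\<close> force the
  others: \<open>2 * (k + 1) ^ 3\<close> in the middle and \<open>(k + 1)\<^sup>2\<close> on the
  right.\<close>

lemma valid_root:
  assumes "k \<ge> 0"
  shows "valid k (root k)"
proof -
  have m: "markov k 1 1 (k + 2)"
    using assms by (simp add: markov_def power2_eq_square algebra_simps)
  have "k + 2 + k * vieta k 1 1 (k + 2) = (k + 1) * (2 * k\<^sup>2 + 4 * k + 2)"
    by (simp add: vieta_def algebra_simps power2_eq_square)
  then have "k + 1 dvd k + 2 + k * vieta k 1 1 (k + 2)" "k + 1 dvd (k + 1)\<^sup>2"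
    by (metis dvd_triv_left) (simp add: power2_eq_square)
  then show ?thesis
    using markov_vieta[OF assms m] unfolding valid_def root_def prod.case
    by (intro conjI; (assumption | (simp add: vieta_def power2_eq_square algebra_simps; fail)))

qed

text \<open>The outer slopes of the root are exactly \<open>k\<close> and \<open>2 * k + 1\<close>;
  the bounds are then cleared of denominators.\<close>

lemma root_slopes:
  assumes k: "k \<ge> 0" and "foldl (child k) (root k) ds = (a, u, b, v, c, w)"
  shows "k * b < 2 * v + k" "2 * v + k < (2 * k + 1) * b"
proof -
  have "valid k (a, u, b, v, c, w)"
    using valid_descendant[OF k valid_root[OF k]] assms(2) by metis
  then have b: "b > 0"
    by (simp add: valid_def markov_def)
  have "slope k (k + 2) ((k + 1)\<^sup>2) = of_int (2 * k + 1)"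
  proof -
    have "2 * (k + 1)\<^sup>2 + k = (2 * k + 1) * (k + 2)"
      by (simp add: power2_eq_square algebra_simps)
    moreover have "real_of_int (k + 2) \<noteq> 0"
      using k by linarith
    ultimately show ?thesis
      unfolding slope_def by (simp only: of_int_mult) simp
  qed
  moreover have "slope k 1 0 = of_int k"
    by (simp add: slope_def)
  ultimately have "real_of_int k < slope k b v" "slope k b v < of_int (2 * k + 1)"
    using descendant_slope[OF k valid_root[OF k, unfolded root_def], of ds] assms(2)
    by (auto simp: root_def mid_slope_def)
  then have "real_of_int (k * b) < of_int (2 * v + k)" "real_of_int (2 * v + k) < of_int ((2 * k + 1) * b)"
    using b by (auto simp: slope_def divide_simps)
  then show "k * b < 2 * v + k" "2 * v + k < (2 * k + 1) * b"
    by (simp_all only: of_int_less_iff)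
qed

text \<open>The jump at \<open>b\<close> yields a triple with the repeated maximum \<open>a\<close>,
  hence all ones, and jumping back gives \<open>k + 2\<close>.\<close>

lemma markov_double:
  assumes k: "k \<ge> 0" and m: "markov k a b a" and "a < b"
  shows "a = 1 \<and> b = k + 2"
proof -
  have le: "vieta k a b a \<le> a"
    using vieta_le[OF k m] assms by simp
  have "markov k a a (vieta k a b a)"
    using markov_swap23[OF markov_vieta[OF k m]] .
  from markov_max_repeated[OF k this le] have "a = 1" "vieta k a b a = 1"
    by auto
  then show ?thesis
    by (simp add: vieta_def)
qed

definition in_tree :: "int \<Rightarrow> int \<Rightarrow> int \<Rightarrow> int \<Rightarrow> bool" where
  "in_tree k a b c \<longleftrightarrow> (\<exists>ds u v w. foldl (child k) (root k) ds = (a, u, b, v, c, w))"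

lemma in_tree_child:
  assumes "in_tree k a b c"
  shows "in_tree k a (vieta k a c b) b" "in_tree k b (vieta k b a c) c"
proof -
  obtain ds u v w where *: "foldl (child k) (root k) ds = (a, u, b, v, c, w)"
    using assms by (auto simp: in_tree_def)
  have "\<exists>u v w. foldl (child k) (root k) (ds @ [True]) = (a, u, vieta k a c b, v, b, w)"
    "\<exists>u v w. foldl (child k) (root k) (ds @ [False]) = (b, u, vieta k b a c, v, c, w)"
    by (simp_all add: *)
  then show "in_tree k a (vieta k a c b) b" "in_tree k b (vieta k b a c) c"
    unfolding in_tree_def by blast+
qed

lemma vieta_commute: "vieta k a b c = vieta k c b a"
  by (simp add: vieta_def algebra_simps)

text \<open>Jumping at \<open>b\<close> leads to a triple with smaller maximum, of which the given
  one is a child up to reflection. The bound on \<open>b\<close> separates these triples from the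
  two with equal outer entries.\<close>

lemma markov_in_tree:
  assumes k: "k \<ge> 0" and "markov k a b c" and "a < b" "c < b" "a \<noteq> c"
  shows "k + 2 < b \<and> (in_tree k a b c \<or> in_tree k c b a)"
  using assms(2-5)
proof (induction "nat b" arbitrary: a b c rule: less_induct)
  case less
  have sorted: "k + 2 < b \<and> (in_tree k a b c \<or> in_tree k c b a)"
    if m: "markov k a b c" and lt: "a < b" "c < a" for a c
  proof -
    define d where "d = vieta k a b c"
    have md: "markov k a d c"
      unfolding d_def using k m by (rule markov_vieta)
    have "d \<noteq> a"
      using markov_max_repeated[OF k, of a c] md lt by auto
    then have "d < a"
      using vieta_le[OF k m] lt by (simp add: d_def)
    have ma: "markov k c a d"
      using md markov_swap12 markov_swap23 by blast
    have b: "b = vieta k a d c" "b = vieta k c d a"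
      unfolding d_def using vieta_vieta vieta_commute by metis+
    show ?thesis
    proof (cases "c = d")
      case True
      then have "c = 1" "d = 1" "a = k + 2"
        using markov_double[OF k, of c a] ma \<open>c < a\<close> by auto
      \<comment> \<open>The empty path: \<open>b\<close> is the middle entry of the root, between 1
        and \<open>k + 2\<close>.\<close>
      then have "foldl (child k) (root k) [] = (c, 0, b, k + 2 + k * b, a, (k + 1)\<^sup>2)"
        using b by (simp add: root_def)
      then show ?thesis
        using \<open>a = k + 2\<close> \<open>a < b\<close> unfolding in_tree_def by blast
    next
      case False
      have "nat a < nat b"
        using m \<open>a < b\<close> by (simp add: markov_def)
      from less.hyps[OF this ma \<open>c < a\<close> \<open>d < a\<close> False]
      show ?thesis
        using in_tree_child b \<open>a < b\<close> by fastforce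
    qed
  qed
  show ?case
  proof (cases "c < a")
    case True
    then show ?thesis
      using sorted less.prems by blast
  next
    case False
    then show ?thesis
      using sorted[of c a] less.prems markov_swap13 by fastforce
  qed
qed

lemma markov_max_cases:
  assumes k: "k \<ge> 0" and m: "markov k a b c" and le: "a \<le> b" "c \<le> b"
  obtains "a = 1" "b = 1" "c = 1" | "a = 1" "b = k + 2" "c = 1"
  | "k + 2 < b" "in_tree k a b c \<or> in_tree k c b a"
proof -
  consider "a = b" | "c = b" | "a < b" "c < b" "a = c" | "a < b" "c < b" "a \<noteq> c"
    using le by linarith
  then show thesis
  proof cases
    case 1
    then show ?thesis
      using markov_max_repeated[OF k, of b c] m le that(1) by simp
  next
    case 2
    then show ?thesis
      using markov_max_repeated[OF k, of b a] markov_swap13[OF m] markov_swap23 le that(1) by simp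
  next
    case 3
    then show ?thesis
      using markov_double[OF k, of a b] m that(2) by simp
  next
    case 4
    then show ?thesis
      using markov_in_tree[OF k m] that(3) by simp
  qed
qed

section \<open>Uniqueness of the triple from the count of roots modulo its maximum\<close>

text \<open>The polynomial is invariant under \<open>t\<close> to \<open>- k - t\<close>, so roots
  come in such pairs; at most one pair is allowed modulo \<open>b\<close>.\<close>

definition two_roots :: "int \<Rightarrow> int \<Rightarrow> bool" where
  "two_roots k b \<longleftrightarrow> (\<forall>s t. b dvd s\<^sup>2 + k * s + 1 \<longrightarrow> b dvd t\<^sup>2 + k * t + 1 \<longrightarrow>
     b dvd s - t \<or> b dvd s + t + k)"

text \<open>Modulo \<open>b\<close>, \<open>v * a\<close> equals \<open>c\<close>, so
  \<open>a\<^sup>2\<close> times the polynomial at \<open>v\<close> becomes the multiple of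
  \<open>b\<close> in \<open>vieta_mult\<close>; \<open>a\<close> is coprime to
  \<open>b\<close>.\<close>

lemma valid_root_mod:
  assumes k: "k \<ge> 0" and v: "valid k (a, u, b, v, c, w)"
  shows "b dvd v\<^sup>2 + k * v + 1"
proof -
  have m: "markov k a b c" and r: "v * a = c + b * (u + k)"
    using v by (auto simp: valid_def algebra_simps)
  have "a\<^sup>2 * (v\<^sup>2 + k * v + 1) = (v * a)\<^sup>2 + k * a * (v * a) + a\<^sup>2"
    by (simp add: power2_eq_square algebra_simps)
  also have "\<dots> = b * vieta k a b c + b * (u + k) * (2 * c + b * (u + k) + k * a)"
    unfolding r vieta_mult[OF m] by (simp add: power2_eq_square algebra_simps)
  finally have "b dvd a\<^sup>2 * (v\<^sup>2 + k * v + 1)"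
    by simp
  moreover have "coprime b (a\<^sup>2)"
    using markov_coprime[OF k m] by (simp add: coprime_commute)
  ultimately show ?thesis
    by (simp add: coprime_dvd_mult_right_iff)
qed

lemma abs_less_dvd_imp_zero:
  fixes n x :: int
  assumes "n dvd x" "\<bar>x\<bar> < n"
  shows "x = 0"
  using assms by (meson dvd_imp_le_int not_less order.strict_trans2 abs_ge_self)

lemma in_tree_unique:
  assumes k: "k \<ge> 0" and roots: "two_roots k b"
    and "in_tree k a b c" "in_tree k a' b c'"
  shows "a = a' \<and> c = c'"
proof -
  obtain ds u v w where *: "foldl (child k) (root k) ds = (a, u, b, v, c, w)"
    using assms by (auto simp: in_tree_def)
  obtain es u' v' w' where **: "foldl (child k) (root k) es = (a', u', b, v', c', w')"
    using assms by (auto simp: in_tree_def)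
  have v: "valid k (a, u, b, v, c, w)" and v': "valid k (a', u', b, v', c', w')"
    using valid_descendant[OF k valid_root[OF k]] * ** by metis+
  then have kv: "k + 1 dvd v" "k + 1 dvd v'" and m: "markov k a b c"
    by (auto simp: valid_def)
  \<comment> \<open>Since \<open>b\<close> is 1 modulo \<open>k + 1\<close>, the two moduli are
    coprime and congruences modulo \<open>b\<close> lift to \<open>(k + 1) * b\<close>.\<close>
  obtain q where "b - 1 = (k + 1) * q"
    using markov_mod_Suc[OF k m] by (auto elim: dvdE)
  then have "b = q * (k + 1) + 1"
    by (simp add: algebra_simps)
  then have cop: "coprime (k + 1) b"
    by (simp add: coprime_iff_gcd_eq_1 gcd_add_mult)
  note bounds = root_slopes[OF k *] root_slopes[OF k **]
  have "b dvd v - v' \<or> b dvd v + v' + k"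
    using roots valid_root_mod[OF k v] valid_root_mod[OF k v'] by (simp add: two_roots_def)
  then have "v = v'"
  proof
    assume "b dvd v - v'"
    then have "(k + 1) * b dvd v - v'"
      using kv cop by (intro divides_mult) auto
    moreover have "\<bar>v - v'\<bar> < (k + 1) * b"
      using bounds by (simp add: algebra_simps abs_less_iff)
    ultimately show ?thesis
      using abs_less_dvd_imp_zero by fastforce
  next
    \<comment> \<open>The shift by \<open>(2 * k + 1) * b\<close> makes \<open>e\<close> divisible
      by \<open>k + 1\<close>. The slope bounds place \<open>e\<close> strictly between
      \<open>- (k + 1) * b\<close> and 0, so this case is contradictory.\<close>
    define e where "e = v + v' + k - (2 * k + 1) * b"
    assume "b dvd v + v' + k"
    then have "b dvd e"
      unfolding e_def by simp
    moreover have "e = v + v' - (k + 1) * b - k * (b - 1)"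
      by (simp add: e_def algebra_simps)
    then have "k + 1 dvd e"
      using kv markov_mod_Suc[OF k m] by simp
    ultimately have "(k + 1) * b dvd e"
      using cop by (intro divides_mult)
    moreover have "\<bar>e\<bar> < (k + 1) * b" "e \<noteq> 0"
      using bounds by (simp_all add: e_def algebra_simps abs_less_iff)
    ultimately show ?thesis
      using abs_less_dvd_imp_zero by blast
  qed
  \<comment> \<open>Equal residues over the same \<open>b\<close> mean equal middle slopes, hence
    the same path.\<close>
  then have "ds = es"
    using mid_slope_inj[OF k valid_root[OF k], of ds es] * ** by (simp add: mid_slope_def)
  then show ?thesis
    using * ** by simp
qed

lemma markov_max_unique:
  assumes k: "k \<ge> 0" and roots: "two_roots k b"
    and m: "markov k a b c" "a \<le> b" "c \<le> b" and m': "markov k a' b c'" "a' \<le> b" "c' \<le> b"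
  shows "a = a' \<and> c = c' \<or> a = c' \<and> c = a'"
  by (rule markov_max_cases[OF k m]; rule markov_max_cases[OF k m'])
    (use k in_tree_unique[OF k roots] in auto)

text \<open>Square roots of the entries give triples for \<open>k = 0\<close> with their maxima in
  the same position, so roots are counted modulo the square root of \<open>b\<close>.\<close>

lemma markov2_max_unique:
  assumes roots: "\<And>n. n > 0 \<Longrightarrow> b = n\<^sup>2 \<Longrightarrow> two_roots 0 n"
    and m: "markov 2 a b c" "a \<le> b" "c \<le> b" and m': "markov 2 a' b c'" "a' \<le> b" "c' \<le> b"
  shows "a = a' \<and> c = c' \<or> a = c' \<and> c = a'"
proof -
  obtain x y z where 1: "x > 0" "y > 0" "z > 0" "a = x\<^sup>2" "b = y\<^sup>2" "c = z\<^sup>2" "markov 0 x y z"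
    using markov2_squares[OF m(1)] by blast
  obtain x' y' z' where 2: "x' > 0" "y' > 0" "z' > 0" "a' = x'\<^sup>2" "b = y'\<^sup>2" "c' = z'\<^sup>2" "markov 0 x' y' z'"
    using markov2_squares[OF m'(1)] by blast
  have "y = y'"
    using 1 2 by (metis power2_eq_imp_eq less_imp_le)
  moreover have "x \<le> y" "z \<le> y" "x' \<le> y'" "z' \<le> y'"
    using 1 2 m m' by (auto intro: power2_le_imp_le)
  ultimately have "x = x' \<and> z = z' \<or> x = z' \<and> z = x'"
    using markov_max_unique[of 0 y x z x' z'] roots[of y] 1 2 by simp
  then show ?thesis
    using 1 2 by blast
qed

section \<open>Roots of the quadratic modulo prime powers and their doubles\<close>

lemma prime_power_dvd_mult_cases:
  fixes p :: int
  assumes p: "prime p" and nd: "\<not> p dvd x - y" and dvd: "p ^ n dvd x * y"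
  shows "p ^ n dvd x \<or> p ^ n dvd y"
proof (cases "p dvd x")
  case True
  then have "\<not> p dvd y"
    using nd dvd_diff by blast
  then have "coprime (p ^ n) y"
    using p by (simp add: prime_imp_coprime)
  then show ?thesis
    using dvd by (simp add: coprime_dvd_mult_left_iff)
next
  case False
  then have "coprime (p ^ n) x"
    using p by (simp add: prime_imp_coprime)
  then show ?thesis
    using dvd by (simp add: coprime_dvd_mult_right_iff)
qed

text \<open>The values at \<open>s\<close> and \<open>t\<close> differ by
  \<open>(s - t) * (s + t + k)\<close>. These factors differ by the derivative
  \<open>2 * t + k\<close> up to sign, so if all roots are simple modulo \<open>p\<close>, one
  factor absorbs the whole power.\<close>

lemma two_roots_prime_power:
  assumes p: "prime p" and nd: "\<And>t. p ^ n dvd t\<^sup>2 + k * t + 1 \<Longrightarrow> \<not> p dvd 2 * t + k"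
  shows "two_roots k (p ^ n)"
  unfolding two_roots_def
proof (intro allI impI)
  fix s t
  assume s: "p ^ n dvd s\<^sup>2 + k * s + 1" and t: "p ^ n dvd t\<^sup>2 + k * t + 1"
  have "(s - t) * (s + t + k) = (s\<^sup>2 + k * s + 1) - (t\<^sup>2 + k * t + 1)"
    by (simp add: power2_eq_square algebra_simps)
  then have "p ^ n dvd (s - t) * (s + t + k)"
    using dvd_diff[OF s t] by simp
  moreover have "\<not> p dvd (s - t) - (s + t + k)"
    using nd[OF t] dvd_minus_iff[of p "2 * t + k"] by (simp add: algebra_simps)
  ultimately show "p ^ n dvd s - t \<or> p ^ n dvd s + t + k"
    using prime_power_dvd_mult_cases[OF p] by blast
qed

text \<open>A root modulo 2 is odd and forces \<open>k\<close> to be even, so both alternatives hold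
  modulo 2 and combine with the one modulo \<open>q\<close>.\<close>

lemma two_roots_double:
  assumes q: "odd q" and roots: "two_roots k q"
  shows "two_roots k (2 * q)"
  unfolding two_roots_def
proof (intro allI impI)
  fix s t
  assume s: "2 * q dvd s\<^sup>2 + k * s + 1" and t: "2 * q dvd t\<^sup>2 + k * t + 1"
  have "even (s\<^sup>2 + k * s + 1)" "even (t\<^sup>2 + k * t + 1)"
    using s t by (meson dvd_mult_left)+
  then have ev: "even (s - t)" "even (s + t + k)"
    by auto
  have "q dvd s - t \<or> q dvd s + t + k"
    using roots s t by (meson dvd_mult_right two_roots_def)
  moreover have "coprime 2 q"
    using q by simp
  ultimately show "2 * q dvd s - t \<or> 2 * q dvd s + t + k"
    using ev divides_mult by blast
qed

text \<open>A double root modulo an odd \<open>p\<close> would make \<open>p\<close> divide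
  \<open>t\<close> and hence 1; the moduli 1 and 2 remain.\<close>

lemma two_roots_markov_prime_power:
  assumes p: "prime p" "odd p \<or> n \<le> 1"
  shows "two_roots 0 (p ^ n)"
proof (cases "odd p \<and> n > 0")
  case True
  show ?thesis
  proof (rule two_roots_prime_power[OF p(1)])
    fix t
    assume "p ^ n dvd t\<^sup>2 + 0 * t + 1"
    moreover have "p dvd p ^ n"
      using True by (intro dvd_power) simp
    ultimately have *: "p dvd t\<^sup>2 + 1"
      using dvd_trans by fastforce
    show "\<not> p dvd 2 * t + 0"
    proof
      assume "p dvd 2 * t + 0"
      moreover have "\<not> p dvd 2"
        using True p primes_dvd_imp_eq[of p 2] by auto
      ultimately have "p dvd t\<^sup>2"
        using p by (simp add: prime_dvd_mult_iff power2_eq_square)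
      then have "p dvd 1"
        using * by (simp add: dvd_add_right_iff)
      then show False
        using p by (simp add: not_prime_unit)
    qed
  qed
next
  case False
  then have "n = 0 \<or> p = 2 \<and> n = 1"
    using p primes_dvd_imp_eq[of 2 p] by auto
  then show ?thesis
    using two_roots_double[of 1 0] by (auto simp: two_roots_def)
qed

text \<open>Holds vacuously: a root modulo 4 is odd and forces \<open>k = 2 * l\<close> with
  \<open>l\<close> odd, so 4 divides one of \<open>l + 1\<close> and \<open>l - 1\<close>.\<close>

lemma two_roots_two_power:
  fixes k :: int
  assumes n: "n \<ge> 2" and "even k \<Longrightarrow> \<not> 4 dvd k div 2 + 1 \<and> \<not> 4 dvd k div 2 - 1"
  shows "two_roots k (2 ^ n)"
proof -
  have False if "2 ^ n dvd t\<^sup>2 + k * t + 1" for t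
  proof -
    have "(4::int) dvd 2 ^ n"
      using le_imp_power_dvd[OF n, of "2::int"] by simp
    then have 4: "4 dvd t\<^sup>2 + k * t + 1"
      using that dvd_trans by blast
    then have "even (t\<^sup>2 + k * t + 1)"
      by (meson dvd_trans even_numeral)
    then have "odd t" "even k"
      by auto
    then obtain j l where t: "t = 2 * j + 1" and k: "k = 2 * l"
      by (auto elim!: oddE evenE)
    have "t\<^sup>2 + k * t + 1 = 4 * (j\<^sup>2 + j + l * j) + 2 * (l + 1)"
      by (simp add: t k power2_eq_square algebra_simps)
    then have "4 dvd 2 * (l + 1)"
      using 4 by (metis dvd_add_right_iff dvd_triv_left)
    then have "4 dvd l + 1 \<or> 4 dvd l - 1"
      by presburger
    then show False
      using assms(2) k by simp
  qed
  then show ?thesis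
    by (auto simp: two_roots_def)
qed

text \<open>As \<open>n \<ge> 2\<close>, a double root modulo \<open>p\<close> makes
  \<open>p\<^sup>2\<close> divide the discriminant \<open>(k + 2) * (k - 2)\<close>. Since
  \<open>p\<close> is odd, it cannot divide both factors, so \<open>p\<^sup>2\<close> divides one of
  them; for even \<open>k\<close> a factor 4 is cancelled first.\<close>

lemma two_roots_odd_prime_power:
  fixes p k :: int
  assumes p: "prime p" "odd p" and n: "n \<ge> 2"
    and even: "even k \<Longrightarrow> \<not> p\<^sup>2 dvd k div 2 + 1 \<and> \<not> p\<^sup>2 dvd k div 2 - 1"
    and odd: "odd k \<Longrightarrow> \<not> p\<^sup>2 dvd k + 2 \<and> \<not> p\<^sup>2 dvd k - 2"
  shows "two_roots k (p ^ n)"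
proof (rule two_roots_prime_power[OF p(1)], rule notI)
  fix t
  assume "p ^ n dvd t\<^sup>2 + k * t + 1"
  then have *: "p\<^sup>2 dvd t\<^sup>2 + k * t + 1"
    using le_imp_power_dvd[OF n] dvd_trans by blast
  assume "p dvd 2 * t + k"
  then have "p\<^sup>2 dvd (2 * t + k)\<^sup>2"
    by simp
  then have "p\<^sup>2 dvd (2 * t + k)\<^sup>2 - 4 * (t\<^sup>2 + k * t + 1)"
    using * by (intro dvd_diff dvd_mult)
  moreover have "(2 * t + k)\<^sup>2 - 4 * (t\<^sup>2 + k * t + 1) = (k + 2) * (k - 2)"
    by (simp add: power2_eq_square algebra_simps)
  ultimately have disc: "p\<^sup>2 dvd (k + 2) * (k - 2)"
    by simp
  have p2: "\<not> p dvd 2"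
    using p primes_dvd_imp_eq[of p 2] by auto
  then have p4: "\<not> p dvd 4"
    using p prime_dvd_mult_iff[of p 2 2] by simp
  show False
  proof (cases "even k")
    case True
    then obtain l where l: "k = 2 * l" ..
    have "p\<^sup>2 dvd 4 * ((l + 1) * (l - 1))"
      using disc by (simp add: l algebra_simps)
    moreover have "coprime (p\<^sup>2) 4"
      using p4 p(1) by (simp add: prime_imp_coprime)
    ultimately have "p\<^sup>2 dvd (l + 1) * (l - 1)"
      by (simp only: coprime_dvd_mult_right_iff)
    then show False
      using prime_power_dvd_mult_cases[of p "l + 1" "l - 1" 2] p p2 even True l by simp
  next
    case False
    then show False
      using prime_power_dvd_mult_cases[of p "k + 2" "k - 2" 2] p p4 odd disc by simp
  qed
qed

section \<open>Back to natural numbers and unordered triples\<close>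

text \<open>If \<open>x\<^sup>2 = 2 * p ^ m\<close>, then 4 divides it, so \<open>p = 2\<close> and
  the factor 2 joins the power.\<close>

lemma square_eq_prime_power:
  fixes p x :: nat
  assumes p: "prime p" and m: "m \<ge> 2" and b: "x\<^sup>2 = p ^ m \<or> x\<^sup>2 = 2 * p ^ m"
  shows "\<exists>j. x = p ^ j"
proof -
  have "\<exists>m'. x\<^sup>2 = p ^ m'"
  proof (cases "x\<^sup>2 = p ^ m")
    case False
    then have eq: "x\<^sup>2 = 2 * p ^ m"
      using b by simp
    then have "even (x\<^sup>2)"
      by simp
    then have "2\<^sup>2 dvd x\<^sup>2"
      by (simp only: pow_divides_pow_iff zero_less_numeral even_power)
    then have "even (p ^ m)"
      by (simp add: eq)
    then have "p = 2"
      using p primes_dvd_imp_eq[of 2 p] by auto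
    then have "x\<^sup>2 = p ^ Suc m"
      using eq by simp
    then show ?thesis ..
  qed blast
  then obtain m' where "x\<^sup>2 = p ^ m'" ..
  then have "x dvd p ^ m'"
    by (metis dvd_triv_left power2_eq_square)
  then show ?thesis
    using p by (auto simp: divides_primepow_nat)
qed

lemma gen_markov_triple_with_max:
  assumes "gen_markov_triple k x y z" "Max {x, y, z} = b"
  shows "\<exists>a c. {#x, y, z#} = {#a, b, c#} \<and> gen_markov_triple k a b c \<and> a \<le> b \<and> c \<le> b"
proof -
  have le: "x \<le> b" "y \<le> b" "z \<le> b" and "b \<in> {x, y, z}"
    using assms(2) Max_in[of "{x, y, z}"] by auto
  then consider "b = x" | "b = y" | "b = z"
    by auto
  then show ?thesis
  proof cases
    case 1
    then show ?thesis
      using le assms(1) markov_swap12 unfolding gen_markov_triple_iff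
      by (intro exI[of _ y] exI[of _ z]) (auto simp: add_mset_commute)
  next
    case 2
    then show ?thesis
      using le assms(1) by blast
  next
    case 3
    then show ?thesis
      using le assms(1) markov_swap23 unfolding gen_markov_triple_iff
      by (intro exI[of _ x] exI[of _ y]) (auto simp: add_mset_commute)
  qed
qed

theorem theorem1p7:
  fixes k b :: nat
  assumes "gen_markov_number k b"
    and "\<exists>p m :: nat. prime p \<and> m \<ge> 2 \<and> (b = p ^ m \<or> b = 2 * p ^ m) \<and>
           (k = 2
            \<or> k \<ge> 4 \<and> even k \<and> \<not> int p ^ 2 dvd int k div 2 + 1 \<and> \<not> int p ^ 2 dvd int k div 2 - 1
            \<or> odd k \<and> \<not> int p ^ 2 dvd int k + 2 \<and> \<not> int p ^ 2 dvd int k - 2)"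
  shows "\<exists>!T :: nat multiset. \<exists>x y z. T = {#x, y, z#} \<and> gen_markov_triple k x y z \<and> Max {x, y, z} = b"
proof -
  obtain p m where p: "prime p" and m: "m \<ge> 2" and b: "b = p ^ m \<or> b = 2 * p ^ m"
    and cond: "k = 2
            \<or> k \<ge> 4 \<and> even k \<and> \<not> int p ^ 2 dvd int k div 2 + 1 \<and> \<not> int p ^ 2 dvd int k div 2 - 1
            \<or> odd k \<and> \<not> int p ^ 2 dvd int k + 2 \<and> \<not> int p ^ 2 dvd int k - 2"
    using assms(2) by blast
  have p': "prime (int p)"
    using p by simp
  have unique: "{#a, b, c#} = {#a', b, c'#}"
    if "gen_markov_triple k a b c" "a \<le> b" "c \<le> b" "gen_markov_triple k a' b c'" "a' \<le> b" "c' \<le> b"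
    for a c a' c'
  proof -
    have "int a = int a' \<and> int c = int c' \<or> int a = int c' \<and> int c = int a'"
    proof (cases "k = 2")
      case True
      have "two_roots 0 n" if n: "n > 0" "int b = n\<^sup>2" for n
      proof -
        define x where "x = nat n"
        have x: "n = int x"
          using n by (simp add: x_def)
        then have bx: "b = x\<^sup>2"
          using n by (metis of_nat_eq_iff of_nat_power)
        then obtain j where j: "x = p ^ j"
          using square_eq_prime_power[OF p m] b by metis
        \<comment> \<open>Passing to the square root can lower the exponent to 1, as for
          \<open>b = 4\<close>, hence the separate treatment of \<open>j \<le> 1\<close>.\<close>
        show ?thesis
        proof (cases "p = 2 \<and> j \<ge> 2")
          case True
          then show ?thesis
            using two_roots_two_power[of j 0] by (simp add: x j)
        next
          case False
          then have "odd (int p) \<or> j \<le> 1"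
            using p primes_dvd_imp_eq[of 2 p] by auto
          then show ?thesis
            using two_roots_markov_prime_power[OF p'] by (simp add: x j)
        qed
      qed
      then show ?thesis
        using markov2_max_unique[of "int b" "int a" "int c" "int a'" "int c'"] that True
        by (simp add: gen_markov_triple_iff)
    next
      case False
      have ev: "\<not> (int p)\<^sup>2 dvd int k div 2 + 1 \<and> \<not> (int p)\<^sup>2 dvd int k div 2 - 1"
        if "even (int k)"
        using cond False that even_of_nat by blast
      have od: "\<not> (int p)\<^sup>2 dvd int k + 2 \<and> \<not> (int p)\<^sup>2 dvd int k - 2"
        if "odd (int k)"
        using cond False that even_of_nat by blast
      have "two_roots (int k) (int b)"
      proof (cases "p = 2")
        case True
        \<comment> \<open>For \<open>p = 2\<close> the factor 2 only raises the exponent, so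
          doubling an odd modulus is needed only for odd \<open>p\<close>.\<close>
        then have "b = 2 ^ m \<or> b = 2 ^ Suc m"
          using b by simp
        then obtain n where "n \<ge> 2" "b = 2 ^ n"
          using m le_SucI by blast
        have "(int p)\<^sup>2 = 4"
          using True by simp
        from two_roots_two_power[OF \<open>n \<ge> 2\<close>, of "int k"] ev[unfolded this]
        have "two_roots (int k) (2 ^ n)" .
        then show ?thesis
          by (simp add: \<open>b = 2 ^ n\<close>)
      next
        case odd: False
        then have "odd (int p)"
          using p primes_dvd_imp_eq[of 2 p] by auto
        moreover from this have "two_roots (int k) (int p ^ m)"
          by (rule two_roots_odd_prime_power[OF p' _ m ev od])
        ultimately show ?thesis
          using b two_roots_double[of "int p ^ m" "int k"] by auto
      qed
      then show ?thesis
        using markov_max_unique[of "int k" "int b" "int a" "int c" "int a'" "int c'"] that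
        by (simp add: gen_markov_triple_iff)
    qed
    then show ?thesis
      by (auto simp: add_mset_commute)
  qed
  obtain x y z where "markov (int k) (int x) (int y) (int z)" "b \<in> {x, y, z}"
    using assms(1) by (auto simp: gen_markov_number_def gen_markov_triple_iff)
  then obtain a c where ac: "markov (int k) a (int b) c" "a \<le> int b" "c \<le> int b"
    using markov_exists_max[of "int k" "int x" "int y" "int z" "int b"] by auto
  then have nn: "a = int (nat a)" "c = int (nat c)"
    by (auto simp: markov_def)
  have t: "gen_markov_triple k (nat a) b (nat c)" "nat a \<le> b" "nat c \<le> b"
    using ac nn by (auto simp: gen_markov_triple_iff)
  show ?thesis
  proof (rule ex1I[of _ "{#nat a, b, nat c#}"])
    have "Max {nat a, b, nat c} = b"
      using t by (intro Max_eqI) auto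
    then show "\<exists>x y z. {#nat a, b, nat c#} = {#x, y, z#} \<and> gen_markov_triple k x y z \<and> Max {x, y, z} = b"
      using t by blast
  next
    fix T
    assume "\<exists>x y z. T = {#x, y, z#} \<and> gen_markov_triple k x y z \<and> Max {x, y, z} = b"
    then obtain a' c' where "T = {#a', b, c'#}" "gen_markov_triple k a' b c'" "a' \<le> b" "c' \<le> b"
      using gen_markov_triple_with_max by metis
    then show "T = {#nat a, b, nat c#}"
      using unique t by blast
  qed
qed

end
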